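(* Let $n\ge 1$. In terms of the polar coordinates $(R,K)$ on $\mathcal{Q}_n$, the length element corresponding to the Riemannian metric $(u,v)_S=\mathrm{Re}\,\mathrm{tr}(S^{-1}uS^{-1}v)$ is given by $$ds^2(R,K) = \sum_{i=1}^n dr_i^2 + 8\sum_{i<j}\sinh^2\left(|r_i-r_j|/2\right)|\theta_{ij}|^2,$$ where $r_i$ denote the diagonal elements of the matrix $R$. That is, the right-hand side is the pullback of the metric under the map $(R,K)\mapsto K\exp(R)K^{-1}$.
   Context: $\mathbb{H}$ is the division algebra of real quaternions, with conjugation $q\mapsto\bar q$, real part $\mathrm{Re}$, and $|q|^2=q\bar q$. $M_n(\mathbb{H})$ is the set of $n\times n$ quaternion matrices with the usual product $(AB)_{ij}=\sum_l A_{il}B_{lj}$; $A^{\dagger}_{ij}=\bar{A}_{ji}$ is the conjugate-transpose. $\mathrm{Sp}(n)$ is the compact Lie group of invertible $K\in M_n(\mathbb{H})$ with $K^{-1}=K^{\dagger}$. $\mathfrak{p}_n=\{X\in M_n(\mathbb{H}): X=X^{\dagger}\}$. $\mathcal{Q}_n$ is the space of positive-definite quaternion matrices: all $S\in M_n(\mathbb{H})$ with $S=S^{\dagger}$ and $\sum_{i,j}\bar{x}_iS_{ij}x_j>0$ for all non-zero $(x_1,\ldots,x_n)\in\mathbb{H}^n$. It is an open subset of $\mathfrak{p}_n$, and $T_S\mathcal{Q}_n$ is identified with $\mathfrak{p}_n$. The Riemannian metric on $\mathcal{Q}_n$ is $(u,v)_S=\mathrm{Re}\,\mathrm{tr}(S^{-1}uS^{-1}v)$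 for $u,v\in\mathfrak{p}_n$. Polar coordinates: each $S\in\mathcal{Q}_n$ can be written $S=K\exp(R)K^{-1}$ with $K\in\mathrm{Sp}(n)$ and $R$ a real diagonal $n \times n$ matrix with diagonal entries $r_1,\ldots,r_n$; any such pair $(R,K)$ is called polar coordinates of $S$ (they are not unique). For $i,j=1,\ldots,n$, $\theta_{ij}$ is the quaternion-valued differential form on $\mathrm{Sp}(n)$ given by $\theta_{ij}(K)=\sum_{l=1}^n K^{\dagger}_{il}\,dK_{lj}$; it satisfies $\theta_{ij}=-\bar{\theta}_{ji}$. *)

theory Defs
  imports "HOL-Analysis.Analysis"
begin

section \<open>Quaternions\<close>

codatatype quat = Quat (qRe: real) (Im1: real) (Im2: real) (Im3: real)

lemma quat_eqI [intro?]:
  "\<lbrakk>qRe x = qRe y; Im1 x = Im1 y; Im2 x = Im2 y; Im3 x = Im3 y\<rbrakk> \<Longrightarrow> x = y"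
  by (rule quat.expand) simp

lemma quat_eq_iff:
  "x = y \<longleftrightarrow> qRe x = qRe y \<and> Im1 x = Im1 y \<and> Im2 x = Im2 y \<and> Im3 x = Im3 y"
  by (auto intro: quat.expand)

instantiation quat :: ring_1
begin

primcorec zero_quat where
  "qRe 0 = 0" | "Im1 0 = 0" | "Im2 0 = 0" | "Im3 0 = 0"

primcorec one_quat where
  "qRe 1 = 1" | "Im1 1 = 0" | "Im2 1 = 0" | "Im3 1 = 0"

primcorec plus_quat where
  "qRe (x + y) = qRe x + qRe y"
| "Im1 (x + y) = Im1 x + Im1 y"
| "Im2 (x + y) = Im2 x + Im2 y"
| "Im3 (x + y) = Im3 x + Im3 y"

primcorec uminus_quat where
  "qRe (- x) = - qRe x"
| "Im1 (- x) = - Im1 x"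
| "Im2 (- x) = - Im2 x"
| "Im3 (- x) = - Im3 x"

primcorec minus_quat where
  "qRe (x - y) = qRe x - qRe y"
| "Im1 (x - y) = Im1 x - Im1 y"
| "Im2 (x - y) = Im2 x - Im2 y"
| "Im3 (x - y) = Im3 x - Im3 y"

primcorec times_quat where
  "qRe (x * y) = qRe x * qRe y - Im1 x * Im1 y - Im2 x * Im2 y - Im3 x * Im3 y"
| "Im1 (x * y) = qRe x * Im1 y + Im1 x * qRe y + Im2 x * Im3 y - Im3 x * Im2 y"
| "Im2 (x * y) = qRe x * Im2 y - Im1 x * Im3 y + Im2 x * qRe y + Im3 x * Im1 y"
| "Im3 (x * y) = qRe x * Im3 y + Im1 x * Im2 y - Im2 x * Im1 y + Im3 x * qRe y"

instance
  by standard (auto simp: quat_eq_iff algebra_simps)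

end

instantiation quat :: real_algebra_1
begin

primcorec scaleR_quat where
  "qRe (scaleR r x) = r * qRe x"
| "Im1 (scaleR r x) = r * Im1 x"
| "Im2 (scaleR r x) = r * Im2 x"
| "Im3 (scaleR r x) = r * Im3 x"

instance
  by standard (auto simp: quat_eq_iff algebra_simps)

end

instantiation quat :: real_normed_vector
begin

definition norm_quat where
  "norm (x::quat) = sqrt ((qRe x)\<^sup>2 + (Im1 x)\<^sup>2 + (Im2 x)\<^sup>2 + (Im3 x)\<^sup>2)"

definition sgn_quat where
  "sgn (x::quat) = x /\<^sub>R norm x"

definition dist_quat where
  "dist (x::quat) y = norm (x - y)"

definition uniformity_quat where
  "(uniformity :: (quat \<times> quat) filter) = (INF e\<in>{0 <..}. principal {(x, y). dist x y < e})"

definition open_quat where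
  "open (U :: quat set) \<longleftrightarrow> (\<forall>x\<in>U. eventually (\<lambda>(x', y). x' = x \<longrightarrow> y \<in> U) uniformity)"

instance
proof
  fix x y :: quat and r :: real
  show "norm x = 0 \<longleftrightarrow> x = 0"
    by (simp add: norm_quat_def quat_eq_iff add_nonneg_eq_0_iff)
  have *: "norm x = norm (Complex (qRe x) (Im1 x), Complex (Im2 x) (Im3 x))" for x
    by (simp add: norm_quat_def norm_prod_def complex_norm add.assoc)
  show "norm (x + y) \<le> norm x + norm y"
    using norm_triangle_ineq[of "(Complex (qRe x) (Im1 x), Complex (Im2 x) (Im3 x))"
        "(Complex (qRe y) (Im1 y), Complex (Im2 y) (Im3 y))"]
    by (simp add: * complex_add)
  have "norm (r *\<^sub>R x) = sqrt (r\<^sup>2 * ((qRe x)\<^sup>2 + (Im1 x)\<^sup>2 + (Im2 x)\<^sup>2 + (Im3 x)\<^sup>2))"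
    by (simp add: norm_quat_def algebra_simps power_mult_distrib)
  then show "norm (r *\<^sub>R x) = \<bar>r\<bar> * norm x"
    by (simp only: norm_quat_def real_sqrt_mult real_sqrt_abs)
qed (auto simp: quat_eq_iff sgn_quat_def dist_quat_def
      uniformity_quat_def open_quat_def algebra_simps)

end

lemma power2_norm_quat: "(norm x)\<^sup>2 = (qRe x)\<^sup>2 + (Im1 x)\<^sup>2 + (Im2 x)\<^sup>2 + (Im3 x)\<^sup>2"
  by (simp add: norm_quat_def)

primcorec qcnj :: "quat \<Rightarrow> quat" where
  "qRe (qcnj x) = qRe x"
| "Im1 (qcnj x) = - Im1 x"
| "Im2 (qcnj x) = - Im2 x"
| "Im3 (qcnj x) = - Im3 x"

instantiation quat :: real_normed_div_algebra
begin

definition inverse_quat where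
  "inverse (x::quat) = qcnj x /\<^sub>R (norm x)\<^sup>2"

definition divide_quat where
  "divide (x::quat) y = x * inverse y"

instance
proof
  fix x y :: quat
  have inv: "x * qcnj x = (norm x)\<^sup>2 *\<^sub>R 1" "qcnj x * x = (norm x)\<^sup>2 *\<^sub>R 1"
    by (simp_all add: quat_eq_iff power2_norm_quat, simp_all add: power2_eq_square)
  show "x \<noteq> 0 \<Longrightarrow> inverse x * x = 1" "x \<noteq> 0 \<Longrightarrow> x * inverse x = 1"
    by (simp_all add: inverse_quat_def inv)
  show "divide x y = x * inverse y" by (rule divide_quat_def)
  show "inverse (0::quat) = 0" by (simp add: inverse_quat_def)
  show "norm (x * y) = norm x * norm y"
    unfolding norm_quat_def real_sqrt_mult [symmetric]
    by (rule arg_cong [where f = sqrt]) (simp add: power2_eq_square algebra_simps)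
qed

end

lemma mult_qcnj: "x * qcnj x = of_real ((norm x)\<^sup>2)"
  by (simp add: quat_eq_iff power2_norm_quat of_real_def, simp add: power2_eq_square)


section \<open>Quaternion matrices\<close>

definition dagger :: "quat^'n^'m \<Rightarrow> quat^'m^'n" where
  "dagger A = (\<chi> i j. qcnj (A $ j $ i))"

definition Sp :: "(quat^'n^'n) set" where
  "Sp = {K. invertible K \<and> matrix_inv K = dagger K}"

definition hermitian :: "(quat^'n^'n) set" where
  "hermitian = {X. X = dagger X}"

text \<open>Quaternions carry no order: positivity of a quaternion means that it is a
  positive real number.\<close>

definition posdef :: "(quat^'n^'n) set" where
  "posdef = {S. S = dagger S \<and>
     (\<forall>x :: quat^'n. x \<noteq> 0 \<longrightarrow>
        (\<exists>c>0. (\<Sum>i\<in>UNIV. \<Sum>j\<in>UNIV. qcnj (x $ i) * S $ i $ j * x $ j) = of_real c))}"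

text \<open>The library's \<^const>\<open>exp\<close> needs an algebra norm, which \<^typ>\<open>quat^'n^'n\<close> does not carry.\<close>

definition matrix_exp :: "quat^'n^'n \<Rightarrow> quat^'n^'n" where
  "matrix_exp A = (\<Sum>k. ((\<lambda>B. A ** B) ^^ k) (mat 1) /\<^sub>R fact k)"

definition real_diag :: "real^'n \<Rightarrow> quat^'n^'n" where
  "real_diag r = (\<chi> i j. if i = j then of_real (r $ i) else 0)"

definition polar :: "(real^'n) \<times> (quat^'n^'n) \<Rightarrow> quat^'n^'n" where
  "polar = (\<lambda>(r, K). K ** matrix_exp (real_diag r) ** matrix_inv K)"

definition Q_metric :: "quat^'n^'n \<Rightarrow> quat^'n^'n \<Rightarrow> quat^'n^'n \<Rightarrow> real" where
  "Q_metric S u v = qRe (trace (matrix_inv S ** u ** matrix_inv S ** v))"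

text \<open>\<open>theta K i j\<close> is the value of the form at the point \<open>K\<close>, as a function of the tangent
  vector \<open>\<kappa>\<close> (the value of \<open>dK\<close>).\<close>

definition theta :: "quat^'n^'n \<Rightarrow> 'n \<Rightarrow> 'n \<Rightarrow> quat^'n^'n \<Rightarrow> quat" where
  "theta K i j \<kappa> = (\<Sum>l\<in>UNIV. dagger K $ i $ l * \<kappa> $ l $ j)"

text \<open>Tangent vectors of an embedded submanifold \<open>M\<close> at \<open>p\<close>, as velocities of curves in \<open>M\<close>.\<close>

definition tangent_space :: "'a::real_normed_vector set \<Rightarrow> 'a \<Rightarrow> 'a set" where
  "tangent_space M p =
     {v. \<exists>\<gamma>. range \<gamma> \<subseteq> M \<and> \<gamma> 0 = p \<and> (\<gamma> has_vector_derivative v) (at (0::real))}"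

end

theory Submission
  imports Defs
begin

text \<open>
  On \<open>Sp\<close> the inverse is the conjugate transpose, so with \<open>E = exp R\<close> the polar map is
  \<open>S = K ** E ** dagger K\<close>, an expression that is multilinear in \<open>K\<close>, \<open>E\<close> and \<open>dagger K\<close> and makes
  sense for all matrices \<open>K\<close>. The product rule differentiates it on the whole ambient space. The set
  \<open>Sp\<close> has empty interior there, so a derivative within \<open>Sp\<close> need not be unique; but its value on a
  tangent vector is the velocity of the image of a curve, and hence is unique
  (\<open>has_derivative_unique_on_tangent\<close>). One may therefore compute with the product rule.

  Put \<open>\<theta> = dagger K ** \<kappa>\<close>. Differentiating \<open>dagger K ** K = mat 1\<close> along \<open>Sp\<close> shows that \<open>\<theta>\<close> is
  skew-Hermitian, so the velocity of \<open>S\<close> is \<open>u = K ** (E ** P + \<theta> ** E - E ** \<theta>) ** dagger K\<close>, where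
  \<open>P\<close> is the diagonal matrix of \<open>\<rho>\<close>. Then \<open>S\<close> inverse times \<open>u\<close> is \<open>K ** W ** dagger K\<close>, where \<open>W\<close>
  has the diagonal entries \<open>\<rho>\<^sub>i\<close> and the off-diagonal entries \<open>(exp (r\<^sub>j - r\<^sub>i) - 1) \<theta>\<^sub>i\<^sub>j\<close>. The real
  part of the quaternionic trace is invariant under cyclic permutations, so the squared length of \<open>u\<close>
  is the real part of the trace of \<open>W ** W\<close> (\<open>Q_metric_polar_deriv\<close>). The entries \<open>(i, j)\<close> and
  \<open>(j, i)\<close> are coupled through \<open>\<theta>\<^sub>i\<^sub>j \<theta>\<^sub>j\<^sub>i = - |\<theta>\<^sub>i\<^sub>j|\<^sup>2\<close> and
  \<open>(exp x - 1) (exp (- x) - 1) = - 4 sinh\<^sup>2 (x / 2)\<close>. Each ordered pair contributes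
  \<open>4 sinh\<^sup>2 ((r\<^sub>i - r\<^sub>j) / 2) |\<theta>\<^sub>i\<^sub>j|\<^sup>2\<close>, and the pairs \<open>i < j\<close> count twice, which gives the factor
  8 (\<open>qRe_trace_square\<close>).
  For \<open>i = j\<close> the exponential factor of \<open>\<theta>\<^sub>i\<^sub>i\<close> is \<open>0\<close>, which is why the \<open>\<theta>\<^sub>i\<^sub>i\<close>, the directions in which
  \<open>K\<close> moves without changing \<open>S\<close>, do not occur.
\<close>

section \<open>Quaternion conjugation\<close>

lemma qcnj_mult: "qcnj (x * y) = qcnj y * qcnj x"
  by (simp add: quat_eq_iff algebra_simps)

lemma qcnj_add [simp]: "qcnj (x + y) = qcnj x + qcnj y"
  by (simp add: quat_eq_iff)

lemma qcnj_zero [simp]: "qcnj 0 = 0"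
  by (simp add: quat_eq_iff)

lemma qcnj_scaleR [simp]: "qcnj (c *\<^sub>R x) = c *\<^sub>R qcnj x"
  by (simp add: quat_eq_iff)

lemma qcnj_of_real [simp]: "qcnj (of_real c) = of_real c"
  by (simp add: quat_eq_iff of_real_def)

lemma qcnj_qcnj [simp]: "qcnj (qcnj x) = x"
  by (simp add: quat_eq_iff)

lemma qcnj_sum: "qcnj (sum f A) = (\<Sum>x\<in>A. qcnj (f x))"
  by (induction A rule: infinite_finite_induct) auto

lemma qRe_sum: "qRe (sum f A) = (\<Sum>x\<in>A. qRe (f x))"
  by (induction A rule: infinite_finite_induct) auto

lemma norm_qcnj [simp]: "norm (qcnj x) = norm x"
  by (simp add: norm_quat_def)

text \<open>Quaternions do not commute, but their commutators are purely imaginary; this is what makes the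
  real part of the trace cyclic.\<close>

lemma qRe_mult_commute: "qRe (x * y) = qRe (y * x)"
  by (simp add: algebra_simps)

lemma qcnj_mult_self: "qcnj x * x = of_real ((norm x)\<^sup>2)"
  using mult_qcnj[of "qcnj x"] by simp

lemma qRe_of_real [simp]: "qRe (of_real c) = c"
  by (simp add: of_real_def)

section \<open>Conjugate transpose and trace\<close>

lemma dagger_nth [simp]: "dagger A $ i $ j = qcnj (A $ j $ i)"
  by (simp add: dagger_def)

lemma dagger_dagger [simp]: "dagger (dagger A) = A"
  by (simp add: vec_eq_iff)

lemma dagger_mult: "dagger (A ** B) = dagger B ** dagger A"
  by (simp add: vec_eq_iff matrix_matrix_mult_def qcnj_sum qcnj_mult)

lemma dagger_add: "dagger (A + B) = dagger A + dagger B"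
  by (simp add: vec_eq_iff)

lemma matrix_inv_unique:
  fixes A :: "'a::semiring_1^'n^'m"
  assumes "A ** B = mat 1" "B ** A = mat 1"
  shows "matrix_inv A = B"
proof -
  have "A ** matrix_inv A = mat 1 \<and> matrix_inv A ** A = mat 1"
    unfolding matrix_inv_def by (rule someI[of _ B]) (use assms in simp)
  then show ?thesis
    using assms by (metis matrix_mul_assoc matrix_mul_rid)
qed

lemma Sp_iff: "K \<in> Sp \<longleftrightarrow> K ** dagger K = mat 1 \<and> dagger K ** K = mat 1"
proof
  assume "K \<in> Sp"
  then show "K ** dagger K = mat 1 \<and> dagger K ** K = mat 1"
    unfolding Sp_def invertible_def matrix_inv_def mem_Collect_eq by (metis (mono_tags, lifting) someI_ex)
next
  assume *: "K ** dagger K = mat 1 \<and> dagger K ** K = mat 1"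
  then have "matrix_inv K = dagger K" by (intro matrix_inv_unique) auto
  with * show "K \<in> Sp"
    unfolding Sp_def invertible_def by auto
qed

lemma Sp_cancel: "K \<in> Sp \<Longrightarrow> A ** dagger K ** (K ** B) = A ** B"
  by (metis Sp_iff matrix_mul_assoc matrix_mul_rid)

lemma qRe_trace_commute:
  fixes A B :: "quat^'n^'n"
  shows "qRe (trace (A ** B)) = qRe (trace (B ** A))"
proof -
  have "qRe (trace (A ** B)) = (\<Sum>i\<in>UNIV. \<Sum>l\<in>UNIV. qRe (A $ i $ l * B $ l $ i))"
    by (simp add: trace_def matrix_matrix_mult_def qRe_sum)
  also have "\<dots> = (\<Sum>l\<in>UNIV. \<Sum>i\<in>UNIV. qRe (B $ l $ i * A $ i $ l))"
    by (subst sum.swap) (simp only: qRe_mult_commute)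
  also have "\<dots> = qRe (trace (B ** A))"
    by (simp only: trace_def matrix_matrix_mult_def qRe_sum vec_lambda_beta)
  finally show ?thesis .
qed

section \<open>Real diagonal matrices and their exponentials\<close>

text \<open>Real scalars are central in the quaternions, so multiplication by a real diagonal matrix scales
  the entries from either side without conjugating them.\<close>

lemma real_diag_mult_nth [simp]: "(real_diag a ** A) $ i $ j = a $ i *\<^sub>R (A $ i $ j)"
proof -
  have "(real_diag a ** A) $ i $ j = (\<Sum>l\<in>UNIV. if i = l then a $ i *\<^sub>R A $ i $ j else 0)"
    unfolding matrix_matrix_mult_def real_diag_def vec_lambda_beta
    by (intro sum.cong) (auto simp: of_real_def)
  then show ?thesis by simp
qed

lemma mult_real_diag_nth [simp]: "(A ** real_diag a) $ i $ j = a $ j *\<^sub>R (A $ i $ j)"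
proof -
  have "(A ** real_diag a) $ i $ j = (\<Sum>l\<in>UNIV. if l = j then a $ j *\<^sub>R A $ i $ j else 0)"
    unfolding matrix_matrix_mult_def real_diag_def vec_lambda_beta
    by (intro sum.cong) (auto simp: of_real_def)
  then show ?thesis by simp
qed

lemma real_diag_nth: "real_diag a $ i $ j = (if i = j then a $ i *\<^sub>R 1 else 0)"
  by (simp add: real_diag_def of_real_def)

lemma real_diag_mult: "real_diag a ** real_diag b = real_diag (a * b)"
  by (auto simp: vec_eq_iff) (auto simp: real_diag_nth)

lemma real_diag_one: "real_diag 1 = mat 1"
  by (simp add: vec_eq_iff real_diag_def mat_def)

lemma dagger_real_diag [simp]: "dagger (real_diag a) = real_diag a"
  by (simp add: vec_eq_iff real_diag_def)

lemma bounded_linear_real_diag: "bounded_linear (real_diag :: real^'n \<Rightarrow> quat^'n^'n)"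
  unfolding linear_conv_bounded_linear[symmetric]
  by (rule linearI) (simp_all add: vec_eq_iff real_diag_nth scaleR_add_left)

definition exp_vec :: "real^'n \<Rightarrow> real^'n" where
  "exp_vec r = (\<chi> i. exp (r $ i))"

lemma exp_vec_minus: "exp_vec r * exp_vec (- r) = 1" "exp_vec (- r) * exp_vec r = 1"
  by (simp_all add: vec_eq_iff exp_vec_def exp_minus)

lemma matrix_exp_real_diag: "matrix_exp (real_diag r) = real_diag (exp_vec r)"
proof -
  have pow: "((\<lambda>B. real_diag r ** B) ^^ k) (mat 1) = real_diag (\<chi> i. r $ i ^ k)" for k
  proof (induction k)
    case 0
    then show ?case by (simp add: real_diag_one[symmetric] one_vec_def)
  next
    case (Suc k)
    then show ?case by (simp add: real_diag_mult times_vec_def)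
  qed
  have "(\<lambda>k. (\<chi> i. r $ i ^ k) /\<^sub>R fact k) sums exp_vec r"
    unfolding sums_def
  proof (rule vec_tendstoI)
    fix i
    show "(\<lambda>n. (\<Sum>k<n. (\<chi> i. r $ i ^ k) /\<^sub>R fact k) $ i) \<longlonglongrightarrow> exp_vec r $ i"
      using exp_converges[of "r $ i"] by (simp add: sums_def exp_vec_def)
  qed
  from bounded_linear.sums[OF bounded_linear_real_diag this]
  have "(\<lambda>k. real_diag (\<chi> i. r $ i ^ k) /\<^sub>R fact k) sums real_diag (exp_vec r)"
    by (simp add: linear_simps[OF bounded_linear_real_diag])
  then show ?thesis
    unfolding matrix_exp_def pow by (rule sums_unique[symmetric])
qed

section \<open>Derivative of the polar map\<close>

text \<open>The two norm estimates reduce boundedness of the conjugate transpose and of matrix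
  multiplication to single entries, where the norm is submultiplicative.\<close>

lemma norm_matrix_le_sum:
  fixes A :: "'a::real_normed_vector^'n^'m"
  shows "norm A \<le> (\<Sum>i\<in>UNIV. \<Sum>j\<in>UNIV. norm (A $ i $ j))"
proof -
  have *: "norm x \<le> (\<Sum>i\<in>UNIV. norm (x $ i))" for x :: "'b::real_normed_vector^'k"
    unfolding norm_vec_def by (rule L2_set_le_sum) simp
  show ?thesis
    by (rule order_trans[OF *], rule sum_mono, rule *)
qed

lemma norm_matrix_entry_le:
  fixes A :: "'a::real_normed_vector^'n^'m"
  shows "norm (A $ i $ j) \<le> norm A"
  by (meson Finite_Cartesian_Product.norm_nth_le order_trans)

lemma bounded_linear_dagger: "bounded_linear (dagger :: quat^'n^'m \<Rightarrow> quat^'m^'n)"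
proof (rule bounded_linear_intro)
  fix A :: "quat^'n^'m"
  have "norm (dagger A) \<le> (\<Sum>i\<in>(UNIV::'n set). \<Sum>j\<in>(UNIV::'m set). norm A)"
    by (intro order_trans[OF norm_matrix_le_sum] sum_mono) (simp add: norm_matrix_entry_le)
  then show "norm (dagger A) \<le> norm A * (real CARD('n) * real CARD('m))"
    by (simp add: mult_ac)
qed (simp_all add: vec_eq_iff)

lemma bounded_bilinear_matrix_mult:
  "bounded_bilinear ((**) :: 'a::real_normed_algebra_1^'n^'m \<Rightarrow> 'a^'p^'n \<Rightarrow> 'a^'p^'m)"
proof
  show "\<exists>K. \<forall>(A::'a^'n^'m) (B::'a^'p^'n). norm (A ** B) \<le> norm A * norm B * K"
  proof (intro exI allI)
    fix A :: "'a^'n^'m" and B :: "'a^'p^'n"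
    have "norm ((A ** B) $ i $ j) \<le> (\<Sum>l\<in>(UNIV::'n set). norm A * norm B)" for i j
      unfolding matrix_matrix_mult_def vec_lambda_beta
      by (rule sum_norm_le)
        (meson mult_mono norm_ge_zero norm_matrix_entry_le norm_mult_ineq order_trans)
    then have "norm (A ** B) \<le> (\<Sum>i\<in>(UNIV::'m set). \<Sum>j\<in>(UNIV::'p set). \<Sum>l\<in>(UNIV::'n set). norm A * norm B)"
      by (intro order_trans[OF norm_matrix_le_sum] sum_mono)
    then show "norm (A ** B) \<le> norm A * norm B * (real CARD('m) * real CARD('p) * real CARD('n))"
      by (simp add: mult_ac)
  qed
qed (simp_all add: vec_eq_iff matrix_matrix_mult_def distrib_left distrib_right sum.distrib scaleR_sum_right)

lemmas matrix_mult_distribs =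
  bounded_bilinear.add_left[OF bounded_bilinear_matrix_mult]
  bounded_bilinear.add_right[OF bounded_bilinear_matrix_mult]
  bounded_bilinear.diff_left[OF bounded_bilinear_matrix_mult]
  bounded_bilinear.diff_right[OF bounded_bilinear_matrix_mult]
  bounded_bilinear.minus_left[OF bounded_bilinear_matrix_mult]
  bounded_bilinear.minus_right[OF bounded_bilinear_matrix_mult]

lemma has_derivative_exp_vec:
  fixes r :: "real^'n"
  shows "(exp_vec has_derivative (\<lambda>h. exp_vec r * h)) (at r within S)"
proof (subst has_derivative_componentwise_within, rule ballI)
  fix b :: "real^'n" assume "b \<in> Basis"
  then obtain i where b: "b = axis i 1" by (auto simp: Basis_vec_def)
  have "((\<lambda>x. exp (x $ i)) has_derivative (\<lambda>h. exp (r $ i) * h $ i)) (at r within S)"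
    by (auto intro!: derivative_eq_intros bounded_linear.has_derivative[OF bounded_linear_vec_nth] simp: mult.commute)
  then show "((\<lambda>x. exp_vec x \<bullet> b) has_derivative (\<lambda>h. (exp_vec r * h) \<bullet> b)) (at r within S)"
    by (simp add: b exp_vec_def cart_eq_inner_axis[symmetric])
qed

text \<open>The polar map with \<open>dagger K\<close> in place of \<open>matrix_inv K\<close>. This makes it differentiable in all
  directions of the ambient space without a study of matrix inversion.\<close>

definition polar_dagger :: "(real^'n) \<times> (quat^'n^'n) \<Rightarrow> quat^'n^'n" where
  "polar_dagger p = snd p ** real_diag (exp_vec (fst p)) ** dagger (snd p)"

lemma polar_eq_polar_dagger: "p \<in> UNIV \<times> Sp \<Longrightarrow> polar p = polar_dagger p"
  by (auto simp: polar_def polar_dagger_def matrix_exp_real_diag Sp_def)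

definition polar_deriv :: "real^'n \<Rightarrow> quat^'n^'n \<Rightarrow> real^'n \<Rightarrow> quat^'n^'n \<Rightarrow> quat^'n^'n" where
  "polar_deriv r K \<rho> \<kappa> = K ** real_diag (exp_vec r) ** dagger \<kappa>
     + (K ** real_diag (exp_vec r * \<rho>) + \<kappa> ** real_diag (exp_vec r)) ** dagger K"

lemma has_derivative_polar_dagger:
  "(polar_dagger has_derivative (\<lambda>(\<rho>, \<kappa>). polar_deriv r K \<rho> \<kappa>)) (at (r, K) within S)"
proof -
  have E: "((\<lambda>p. real_diag (exp_vec (fst p))) has_derivative (\<lambda>h. real_diag (exp_vec r * fst h))) (at (r, K) within S)"
    using bounded_linear.has_derivative[OF bounded_linear_real_diag
      has_derivative_in_compose[OF has_derivative_fst[OF has_derivative_ident] has_derivative_exp_vec],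
      of "(r, K)" S]
    by simp
  have snd: "(snd has_derivative snd) (at (r, K) within S)"
    by (rule has_derivative_snd[OF has_derivative_ident])
  note mult = bounded_bilinear.FDERIV[OF bounded_bilinear_matrix_mult]
  from mult[OF mult[OF snd E] bounded_linear.has_derivative[OF bounded_linear_dagger snd]]
  show ?thesis
    by (simp add: polar_dagger_def[abs_def] polar_deriv_def case_prod_unfold)
qed

lemma has_derivative_polar:
  assumes "K \<in> Sp"
  shows "(polar has_derivative (\<lambda>(\<rho>, \<kappa>). polar_deriv r K \<rho> \<kappa>)) (at (r, K) within UNIV \<times> Sp)"
  by (rule has_derivative_transform[OF _ _ has_derivative_polar_dagger])
    (use assms in \<open>auto simp: polar_eq_polar_dagger\<close>)

text \<open>A derivative within a thin set \<open>M\<close> need not be determined in directions transversal to \<open>M\<close>. On a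
  tangent vector it is: composition with a curve in \<open>M\<close> reduces the question to functions of one real
  variable, whose velocity is unique.\<close>

lemma has_derivative_unique_on_tangent:
  assumes v: "v \<in> tangent_space M p"
    and D: "(f has_derivative D) (at p within M)" and D': "(f has_derivative D') (at p within M)"
  shows "D v = D' v"
proof -
  from v obtain \<gamma> where \<gamma>: "range \<gamma> \<subseteq> M" "\<gamma> 0 = p"
    and deriv: "(\<gamma> has_vector_derivative v) (at (0::real))"
    by (auto simp: tangent_space_def)
  have "((f \<circ> \<gamma>) has_vector_derivative L v) (at 0)" if L: "(f has_derivative L) (at p within M)" for L
  proof -
    have "(f has_derivative L) (at (\<gamma> 0) within range \<gamma>)"
      using has_derivative_subset[OF L \<gamma>(1)] \<gamma>(2) by simp
    from diff_chain_within[OF deriv[unfolded has_vector_derivative_def] this]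
    have "((f \<circ> \<gamma>) has_derivative (\<lambda>t. L (t *\<^sub>R v))) (at 0)"
      by (simp add: o_def)
    then show ?thesis
      unfolding has_vector_derivative_def
      using linear_simps(5)[OF has_derivative_bounded_linear[OF L]] by simp
  qed
  from vector_derivative_unique_at[OF this[OF D] this[OF D']] show ?thesis .
qed

text \<open>The left-hand side is the derivative of \<open>dagger K ** K\<close>, which is constant on \<open>Sp\<close>. That it
  vanishes means that \<open>dagger K ** \<kappa>\<close> is skew-Hermitian: left translation carries the tangent
  spaces of \<open>Sp\<close> into its Lie algebra.\<close>

lemma tangent_Sp:
  assumes "K \<in> Sp" and tangent: "(\<rho>, \<kappa>) \<in> tangent_space (UNIV \<times> Sp) (r, K)"
  shows "dagger K ** \<kappa> + dagger \<kappa> ** K = 0"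
proof -
  have snd: "(snd has_derivative snd) (at (r, K) within UNIV \<times> Sp)"
    by (rule has_derivative_snd[OF has_derivative_ident])
  have "((\<lambda>p. dagger (snd p) ** snd p) has_derivative (\<lambda>h. dagger K ** snd h + dagger (snd h) ** K))
      (at (r, K) within UNIV \<times> Sp)"
    using bounded_bilinear.FDERIV[OF bounded_bilinear_matrix_mult
       bounded_linear.has_derivative[OF bounded_linear_dagger snd] snd] by simp
  then have "((\<lambda>_. mat 1) has_derivative (\<lambda>h. dagger K ** snd h + dagger (snd h) ** K))
      (at (r, K) within UNIV \<times> Sp)"
    by (rule has_derivative_transform[rotated 2]) (use assms(1) in \<open>auto simp: Sp_iff\<close>)
  from has_derivative_unique_on_tangent[OF tangent this has_derivative_const] show ?thesis by simp
qed

section \<open>Positive definiteness\<close>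

text \<open>Substituting \<open>y = dagger K *v x\<close>, which is non-zero with \<open>x\<close>, turns the quadratic form into the
  weighted sum of squares \<open>\<Sum>l. d\<^sub>l |y\<^sub>l|\<^sup>2\<close>.\<close>

lemma conjugate_posdef:
  fixes K :: "quat^'n^'n"
  assumes K: "K \<in> Sp" and d: "\<And>i. d $ i > 0"
  shows "K ** real_diag d ** dagger K \<in> posdef"
proof -
  let ?S = "K ** real_diag d ** dagger K"
  have "\<exists>c>0. (\<Sum>i\<in>UNIV. \<Sum>j\<in>UNIV. qcnj (x $ i) * ?S $ i $ j * x $ j) = of_real c"
    if x: "x \<noteq> 0" for x :: "quat^'n"
  proof -
    define y where "y = dagger K *v x"
    have y_nth: "y $ l = (\<Sum>j\<in>UNIV. qcnj (K $ j $ l) * x $ j)" for l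
      by (simp add: y_def matrix_vector_mult_def)
    have "K *v y = x"
      using K by (simp add: y_def matrix_vector_mul_assoc Sp_iff)
    with x have "y \<noteq> 0" by auto
    then obtain l where l: "y $ l \<noteq> 0" by (auto simp: vec_eq_iff)
    have S_nth: "?S $ i $ j = (\<Sum>l\<in>UNIV. d $ l *\<^sub>R (K $ i $ l * qcnj (K $ j $ l)))" for i j
      by (subst matrix_matrix_mult_def) simp
    have "(\<Sum>i\<in>UNIV. \<Sum>j\<in>UNIV. qcnj (x $ i) * ?S $ i $ j * x $ j)
        = (\<Sum>i\<in>UNIV. \<Sum>j\<in>UNIV. \<Sum>l\<in>UNIV. d $ l *\<^sub>R ((qcnj (x $ i) * K $ i $ l) * (qcnj (K $ j $ l) * x $ j)))"
      by (simp add: S_nth sum_distrib_left sum_distrib_right mult.assoc)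
    also have "\<dots> = (\<Sum>i\<in>UNIV. \<Sum>l\<in>UNIV. \<Sum>j\<in>UNIV. d $ l *\<^sub>R ((qcnj (x $ i) * K $ i $ l) * (qcnj (K $ j $ l) * x $ j)))"
      by (intro sum.cong refl sum.swap)
    also have "\<dots> = (\<Sum>l\<in>UNIV. \<Sum>i\<in>UNIV. \<Sum>j\<in>UNIV. d $ l *\<^sub>R ((qcnj (x $ i) * K $ i $ l) * (qcnj (K $ j $ l) * x $ j)))"
      by (rule sum.swap)
    also have "\<dots> = (\<Sum>l\<in>UNIV. d $ l *\<^sub>R (qcnj (y $ l) * y $ l))"
      by (simp add: y_nth qcnj_sum qcnj_mult sum_product scaleR_sum_right)
    also have "\<dots> = of_real (\<Sum>l\<in>UNIV. d $ l * (norm (y $ l))\<^sup>2)"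
      by (simp add: qcnj_mult_self scaleR_conv_of_real del: of_real_power)
    finally have eq: "(\<Sum>i\<in>UNIV. \<Sum>j\<in>UNIV. qcnj (x $ i) * ?S $ i $ j * x $ j)
        = of_real (\<Sum>l\<in>UNIV. d $ l * (norm (y $ l))\<^sup>2)" .
    have "0 < (\<Sum>l\<in>UNIV. d $ l * (norm (y $ l))\<^sup>2)"
      by (rule sum_pos2[of _ l]) (use d l in \<open>auto simp: less_imp_le\<close>)
    with eq show ?thesis by blast
  qed
  moreover have "?S = dagger ?S"
    by (simp add: dagger_mult matrix_mul_assoc)
  ultimately show ?thesis by (simp add: posdef_def)
qed

section \<open>The metric in polar coordinates\<close>

lemma polar_deriv_hermitian: "polar_deriv r K \<rho> \<kappa> \<in> hermitian"
  by (simp add: hermitian_def polar_deriv_def dagger_add dagger_mult matrix_mul_assoc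
      matrix_mult_distribs add_ac)

lemma sum_pairs_linorder:
  fixes g :: "'n::{finite,linorder} \<Rightarrow> 'n \<Rightarrow> real"
  assumes "\<And>i j. g i j = g j i"
  shows "(\<Sum>i\<in>UNIV. \<Sum>j\<in>UNIV. g i j) = (\<Sum>i\<in>UNIV. g i i) + 2 * (\<Sum>(i, j) | i < j. g i j)"
proof -
  let ?g = "\<lambda>(i, j). g i j"
  have "(\<Sum>i\<in>UNIV. \<Sum>j\<in>UNIV. g i j) = sum ?g UNIV"
    by (simp add: sum.cartesian_product)
  also have "(UNIV :: ('n \<times> 'n) set) = range (\<lambda>i. (i, i)) \<union> ({(i, j). i < j} \<union> {(i, j). j < i})"
    by auto
  also have "sum ?g \<dots> = sum ?g (range (\<lambda>i. (i, i))) + (sum ?g {(i, j). i < j} + sum ?g {(i, j). j < i})"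
    by (subst sum.union_disjoint; (subst sum.union_disjoint)?) auto
  also have "sum ?g {(i, j). j < i} = sum ?g {(i, j). i < j}"
    by (rule sum.reindex_bij_witness[of _ "\<lambda>(i, j). (j, i)" "\<lambda>(i, j). (j, i)"]) (auto simp: assms)
  also have "sum ?g (range (\<lambda>i. (i, i))) = (\<Sum>i\<in>UNIV. g i i)"
    by (subst sum.reindex) (auto simp: inj_on_def)
  finally show ?thesis by simp
qed

lemma exp_diff_sinh:
  fixes a b :: real
  shows "(exp (b - a) - 1) * (exp (a - b) - 1) = - 4 * (sinh (\<bar>a - b\<bar> / 2))\<^sup>2"
proof -
  define x where "x = \<bar>a - b\<bar> / 2"
  have "(2 * sinh x)\<^sup>2 = (exp x - exp (- x))\<^sup>2"
    by (simp add: sinh_field_def diff_divide_distrib)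
  also have "\<dots> = exp (2 * x) + exp (- (2 * x)) - 2"
    using exp_minus_inverse[of x] exp_double[of x] exp_double[of "- x"]
    by (simp add: power2_diff)
  finally have "4 * (sinh x)\<^sup>2 = exp (2 * x) + exp (- (2 * x)) - 2"
    by (simp add: power_mult_distrib)
  moreover have "2 * x = a - b \<or> 2 * x = b - a"
    by (simp add: x_def abs_if)
  then have "exp (2 * x) + exp (- (2 * x)) = exp (a - b) + exp (b - a)"
    by (elim disjE) (simp_all only: minus_diff_eq add.commute)
  moreover have "exp (b - a) * exp (a - b) = 1"
    by (simp flip: exp_add)
  ultimately show ?thesis
    unfolding x_def[symmetric] by (simp add: algebra_simps)
qed

lemma qRe_trace_square:
  fixes \<theta> :: "((quat, 'n::{finite,linorder}) vec, 'n) vec"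
  assumes skew: "dagger \<theta> = - \<theta>"
    and W: "W = real_diag (exp_vec (- r)) ** (real_diag (exp_vec r * \<rho>) + \<theta> ** real_diag (exp_vec r) - real_diag (exp_vec r) ** \<theta>)"
  shows "qRe (trace (W ** W)) = (\<Sum>i\<in>UNIV. (\<rho> $ i)\<^sup>2) +
         8 * (\<Sum>(i, j) | i < j. (sinh (\<bar>r $ i - r $ j\<bar> / 2))\<^sup>2 * (norm (\<theta> $ i $ j))\<^sup>2)"
proof -
  have skew_nth: "qcnj (\<theta> $ j $ i) = - \<theta> $ i $ j" for i j
    using skew by (simp add: vec_eq_iff)
  have W_nth: "W $ i $ j = (if i = j then of_real (\<rho> $ i) else (exp (r $ j - r $ i) - 1) *\<^sub>R \<theta> $ i $ j)" for i j
    by (simp add: W real_diag_nth exp_vec_def exp_diff exp_minus of_real_def algebra_simps divide_inverse)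
  \<comment> \<open>the contribution of an ordered pair; it vanishes for \<open>i = j\<close>\<close>
  define s where "s i j = 4 * ((sinh (\<bar>r $ i - r $ j\<bar> / 2))\<^sup>2 * (norm (\<theta> $ i $ j))\<^sup>2)" for i j
  have s: "s i j = s j i" for i j
  proof -
    have "norm (\<theta> $ i $ j) = norm (\<theta> $ j $ i)"
      by (metis norm_minus_cancel norm_qcnj skew_nth)
    then show ?thesis by (simp add: s_def abs_minus_commute)
  qed
  have entry: "qRe (W $ i $ j * W $ j $ i) = (if i = j then (\<rho> $ i)\<^sup>2 else 0) + s i j" for i j
  proof (cases "i = j")
    case True
    then show ?thesis by (simp add: W_nth s_def power2_eq_square flip: of_real_mult)
  next
    case False
    have "\<theta> $ i $ j * \<theta> $ j $ i = - of_real ((norm (\<theta> $ i $ j))\<^sup>2)"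
      using mult_qcnj[of "\<theta> $ i $ j"] skew_nth[of i j] by (metis minus_mult_right minus_minus)
    with False have "qRe (W $ i $ j * W $ j $ i)
        = - ((exp (r $ j - r $ i) - 1) * (exp (r $ i - r $ j) - 1) * (norm (\<theta> $ i $ j))\<^sup>2)"
      by (simp add: W_nth del: of_real_power times_quat.simps)
    also have "\<dots> = s i j"
      unfolding exp_diff_sinh by (simp add: s_def)
    finally show ?thesis using False by simp
  qed
  have "qRe (trace (W ** W)) = (\<Sum>i\<in>UNIV. \<Sum>j\<in>UNIV. qRe (W $ i $ j * W $ j $ i))"
    unfolding trace_def matrix_matrix_mult_def vec_lambda_beta qRe_sum ..
  also have "\<dots> = (\<Sum>i\<in>UNIV. (\<rho> $ i)\<^sup>2) + (\<Sum>i\<in>UNIV. \<Sum>j\<in>UNIV. s i j)"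
    by (simp only: entry sum.distrib) simp
  also have "(\<Sum>i\<in>UNIV. \<Sum>j\<in>UNIV. s i j) = 2 * (\<Sum>(i, j) | i < j. s i j)"
    by (subst sum_pairs_linorder[OF s]) (simp add: s_def)
  finally show ?thesis
    by (simp add: s_def case_prod_unfold sum_distrib_left)
qed

lemma Q_metric_polar_deriv:
  fixes K :: "((quat, 'n::{finite,linorder}) vec, 'n) vec"
  assumes K: "K \<in> Sp" and skew: "dagger K ** \<kappa> + dagger \<kappa> ** K = 0"
  shows "Q_metric (polar (r, K)) (polar_deriv r K \<rho> \<kappa>) (polar_deriv r K \<rho> \<kappa>) =
         (\<Sum>i\<in>UNIV. (\<rho> $ i)\<^sup>2) +
         8 * (\<Sum>(i, j) | i < j. (sinh (\<bar>r $ i - r $ j\<bar> / 2))\<^sup>2 * (norm (theta K i j \<kappa>))\<^sup>2)"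
proof -
  define \<theta> where "\<theta> = dagger K ** \<kappa>"
  define E where "E = (real_diag (exp_vec r) :: ((quat, 'n) vec, 'n) vec)"
  define E' where "E' = (real_diag (exp_vec (- r)) :: ((quat, 'n) vec, 'n) vec)"
  define T where "T = real_diag (exp_vec r * \<rho>) + \<theta> ** E - E ** \<theta>"
  have KK: "K ** dagger K = mat 1" "dagger K ** K = mat 1"
    using K by (auto simp: Sp_iff)
  note cancel = Sp_cancel[OF K]
  have skew': "dagger \<theta> = - \<theta>"
    using skew by (simp add: \<theta>_def dagger_mult eq_neg_iff_add_eq_0 add.commute)
  have \<kappa>: "\<kappa> = K ** \<theta>"
    using KK by (simp add: \<theta>_def matrix_mul_assoc)
  have D: "polar_deriv r K \<rho> \<kappa> = K ** T ** dagger K"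
    by (simp add: polar_deriv_def T_def \<kappa> dagger_mult skew' matrix_mul_assoc
      matrix_mult_distribs E_def real_diag_mult[symmetric])
  have EE: "E ** E' = mat 1" "E' ** E = mat 1"
    by (simp_all add: E_def E'_def real_diag_mult exp_vec_minus real_diag_one)
  have inv: "matrix_inv (polar (r, K)) = K ** E' ** dagger K"
  proof (rule matrix_inv_unique)
    have P: "polar (r, K) = K ** E ** dagger K"
      using polar_eq_polar_dagger[of "(r, K)"] K by (simp add: polar_dagger_def E_def)
    show "polar (r, K) ** (K ** E' ** dagger K) = mat 1"
      unfolding P by (metis KK(1) EE(1) matrix_mul_assoc cancel matrix_mul_rid)
    show "(K ** E' ** dagger K) ** polar (r, K) = mat 1"
      unfolding P by (metis KK(1) EE(2) matrix_mul_assoc cancel matrix_mul_rid)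
  qed
  \<comment> \<open>with \<open>S = polar (r, K)\<close>, the inverse of \<open>S\<close> times its velocity, up to conjugation by \<open>K\<close>\<close>
  define W where "W = E' ** T"
  have "K ** E' ** dagger K ** (K ** T ** dagger K) = K ** W ** dagger K"
    unfolding W_def by (metis matrix_mul_assoc cancel)
  then have "Q_metric (polar (r, K)) (polar_deriv r K \<rho> \<kappa>) (polar_deriv r K \<rho> \<kappa>)
      = qRe (trace (K ** W ** dagger K ** (K ** W ** dagger K)))"
    unfolding Q_metric_def inv D by (metis matrix_mul_assoc)
  also have "\<dots> = qRe (trace (K ** (W ** W ** dagger K)))"
    by (metis matrix_mul_assoc cancel)
  also have "\<dots> = qRe (trace (W ** W))"
    by (subst qRe_trace_commute) (metis matrix_mul_assoc KK(2) matrix_mul_rid)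
  also have "\<dots> = (\<Sum>i\<in>UNIV. (\<rho> $ i)\<^sup>2) +
         8 * (\<Sum>(i, j) | i < j. (sinh (\<bar>r $ i - r $ j\<bar> / 2))\<^sup>2 * (norm (\<theta> $ i $ j))\<^sup>2)"
    by (rule qRe_trace_square[OF skew']) (simp add: W_def T_def E_def E'_def)
  finally show ?thesis
    by (simp add: \<theta>_def theta_def matrix_matrix_mult_def)
qed

theorem proposition2:
  fixes r :: "(real, 'n::{finite,linorder}) vec" and K :: "((quat, 'n) vec, 'n) vec"
  assumes "K \<in> Sp"
  shows "polar (r, K) \<in> posdef \<and>
    polar differentiable (at (r, K) within UNIV \<times> Sp) \<and>
    (\<forall>D \<rho> \<kappa>. (polar has_derivative D) (at (r, K) within UNIV \<times> Sp) \<longrightarrow>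
       (\<rho>, \<kappa>) \<in> tangent_space (UNIV \<times> Sp) (r, K) \<longrightarrow>
       D (\<rho>, \<kappa>) \<in> hermitian \<and>
       Q_metric (polar (r, K)) (D (\<rho>, \<kappa>)) (D (\<rho>, \<kappa>)) =
         (\<Sum>i\<in>UNIV. (\<rho> $ i)\<^sup>2) +
         8 * (\<Sum>(i, j) | i < j. (sinh (\<bar>r $ i - r $ j\<bar> / 2))\<^sup>2 * (norm (theta K i j \<kappa>))\<^sup>2))"
proof (intro conjI allI impI)
  show "polar (r, K) \<in> posdef"
    using polar_eq_polar_dagger[of "(r, K)"] assms conjugate_posdef[OF assms, of "exp_vec r"]
    by (simp add: polar_dagger_def exp_vec_def)
  show "polar differentiable (at (r, K) within UNIV \<times> Sp)"
    using has_derivative_polar[OF assms] by (auto simp: differentiable_def)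
next
  fix D \<rho> \<kappa>
  assume D: "(polar has_derivative D) (at (r, K) within UNIV \<times> Sp)"
    and tangent: "(\<rho>, \<kappa>) \<in> tangent_space (UNIV \<times> Sp) (r, K)"
  have D_eq: "D (\<rho>, \<kappa>) = polar_deriv r K \<rho> \<kappa>"
    using has_derivative_unique_on_tangent[OF tangent D has_derivative_polar[OF assms]] by simp
  show "D (\<rho>, \<kappa>) \<in> hermitian"
    unfolding D_eq by (rule polar_deriv_hermitian)
  show "Q_metric (polar (r, K)) (D (\<rho>, \<kappa>)) (D (\<rho>, \<kappa>)) =
         (\<Sum>i\<in>UNIV. (\<rho> $ i)\<^sup>2) +
         8 * (\<Sum>(i, j) | i < j. (sinh (\<bar>r $ i - r $ j\<bar> / 2))\<^sup>2 * (norm (theta K i j \<kappa>))\<^sup>2)"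
    unfolding D_eq by (rule Q_metric_polar_deriv[OF assms tangent_Sp[OF assms tangent]])
qed

end
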